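(* For any $\alpha>0$ there exists a randomized online algorithm (a variant of \textsc{Ranking}) for the Online Vertex-Weighted Bipartite Matching Problem such that for any instance $G=(S,B,E)$ with weights $w:S\to\mathbb{R}_+$, any arrival order of $B$, and any matching $M^*$ of $G$, \[ \mathbb{P}\left[w(M) < \left(1-\frac{1}{e}-\alpha\right)w(M^* )\right] < e^{-\frac{1}{50}\alpha^4\frac{w(M^* )^2}{\|w\|_2^2}}, \] where $M$ denotes the matching generated by the algorithm, $w(M)\coloneqq\sum_{\{i,j\}\in M} w_j$ with $j\in S$ the seller endpoint of each edge, and $\|w\|_2^2=\sum_{j\in S}w_j^2$.
   Context: Online Vertex-Weighted Bipartite Matching Problem: $G=(S,B,E)$ is a bipartite graph with offline vertices $S$ carrying nonnegative weights $w:S\to\mathbb{R}_+$ and online vertices $B$ that arrive one at a time in adversarial order. When $i\in B$ arrives, its neighborhood $N(i)\subseteq S$ is revealed and the algorithm must irrevocably match $i$ to a currently unmatched neighbor or leave it unmatched. The goal is to maximize the total weight of matched offline vertices. *)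

theory Defs
  imports "HOL-Probability.Probability"
begin

text \<open>Online vertex-weighted bipartite matching.
  An instance consists of a finite set S of offline vertices with weights w,
  and an arrival sequence of online vertices, given as the list of their
  neighbourhoods (the i-th list entry is N(i) for the i-th arriving vertex).\<close>

type_synonym 's history = "('s set \<times> 's option) list"

text \<open>A randomized online algorithm (behaviour form): when an online vertex
  arrives, it sees the offline data (S, w), the full history so far (previous
  neighbourhoods and previous decisions) and the new neighbourhood, and outputs
  a probability distribution over decisions (None = leave unmatched,
  Some j = match to j).\<close>

type_synonym 's online_alg = "'s set \<Rightarrow> ('s \<Rightarrow> real) \<Rightarrow> 's history \<Rightarrow> 's set \<Rightarrow> 's option pmf"

definition matched_in :: "'s history \<Rightarrow> 's set" where
  "matched_in h = {j. \<exists>N. (N, Some j) \<in> set h}"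

definition legal_choice :: "'s history \<Rightarrow> 's set \<Rightarrow> 's option \<Rightarrow> 's option" where
  "legal_choice h N c = (case c of None \<Rightarrow> None
      | Some j \<Rightarrow> (if j \<in> N \<and> j \<notin> matched_in h then Some j else None))"

fun run_from :: "'s online_alg \<Rightarrow> 's set \<Rightarrow> ('s \<Rightarrow> real) \<Rightarrow> 's history \<Rightarrow> 's set list \<Rightarrow> 's history pmf" where
  "run_from A S w h [] = return_pmf h"
| "run_from A S w h (N # Ns) =
     bind_pmf (A S w h N) (\<lambda>c. run_from A S w (h @ [(N, legal_choice h N c)]) Ns)"

definition run_alg :: "'s online_alg \<Rightarrow> 's set \<Rightarrow> ('s \<Rightarrow> real) \<Rightarrow> 's set list \<Rightarrow> 's history pmf" where
  "run_alg A S w Ns = run_from A S w [] Ns"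

definition hist_weight :: "('s \<Rightarrow> real) \<Rightarrow> 's history \<Rightarrow> real" where
  "hist_weight w h = sum_list (map (\<lambda>(N, c). case c of None \<Rightarrow> 0 | Some j \<Rightarrow> w j) h)"

definition is_matching :: "'s set list \<Rightarrow> (nat \<times> 's) set \<Rightarrow> bool" where
  "is_matching Ns M \<longleftrightarrow>
     (\<forall>(i, j) \<in> M. i < length Ns \<and> j \<in> Ns ! i) \<and>
     (\<forall>(i, j) \<in> M. \<forall>(i', j') \<in> M. (i = i' \<longleftrightarrow> j = j'))"

definition matching_weight :: "('s \<Rightarrow> real) \<Rightarrow> (nat \<times> 's) set \<Rightarrow> real" where
  "matching_weight w M = (\<Sum>(i, j)\<in>M. w j)"

end

theory Submission
  imports Defs
begin

text \<open>Every offline vertex draws a uniform rank; an arriving vertex takes the free neighbour with the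
  highest score, that is weight times a discount that decreases with the rank. Crediting the score of a matched
  vertex \<open>j\<close> to its partner and the rest of \<open>w j\<close> to \<open>j\<close>, the average over the rank of \<open>j\<close> alone
  already gives every edge of a matching a share close to \<open>(1 - 1 / e) w j\<close>.

  Deleting \<open>j\<close> changes the set of unmatched vertices along an alternating path of decreasing scores, so
  it frees at most one other vertex, whose score is at most that of \<open>j\<close>. The discount is kept above
  \<open>\<delta> = \<alpha> / 2\<close>, which costs at most \<open>\<delta>\<close> in expectation, but bounds the weight of the freed vertex
  by \<open>w j / \<delta>\<close>. Hence McDiarmid's inequality applies with differences \<open>w j / \<delta>\<close>, and a deviation
  of \<open>\<alpha> / 4\<close> gives the exponent \<open>\<alpha> ^ 4 / 32 > \<alpha> ^ 4 / 50\<close>.\<close>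

section \<open>Lotteries over deterministic strategies\<close>

text \<open>Law of total probability: drawing the value of \<open>g\<close> first and then a point
  conditioned on it is the same as drawing the point. On the support of the conditional law,
  \<open>c\<close> equals \<open>g x\<close>, so \<open>R\<close> may depend on either.\<close>

lemma bind_map_cond_pmf:
  "bind_pmf (map_pmf g Q) (\<lambda>c. map_pmf (R c) (cond_pmf Q {x. g x = c})) = map_pmf (\<lambda>x. R (g x) x) Q"
proof -
  have cond: "set_pmf (cond_pmf Q {x. g x = g y}) = set_pmf Q \<inter> {x. g x = g y}" if "y \<in> set_pmf Q" for y
    using that by (intro set_cond_pmf) auto
  have "bind_pmf (map_pmf g Q) (\<lambda>c. map_pmf (R c) (cond_pmf Q {x. g x = c})) =
      bind_pmf (map_pmf g Q) (\<lambda>c. map_pmf (\<lambda>x. R (g x) x) (cond_pmf Q {x. g x = c}))"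
    by (intro bind_pmf_cong refl map_pmf_cong) (auto simp: cond)
  also have "\<dots> = map_pmf (\<lambda>x. R (g x) x) (bind_pmf (map_pmf g Q) (\<lambda>c. cond_pmf Q {x. g x = c}))"
    by (simp add: map_bind_pmf)
  also have "bind_pmf (map_pmf g Q) (\<lambda>c. cond_pmf Q {x. g x = c}) = Q"
    by (rule bind_cond_pmf_cancel)
      (auto simp: vimage_def eq_commute intro!: arg_cong[where f = "measure_pmf.prob Q"])
  finally show ?thesis .
qed

text \<open>The normalisation by \<open>measure P A\<close> cancels; nonemptiness keeps all three
  conditionings well defined.\<close>

lemma cond_cond_pmf:
  assumes "set_pmf P \<inter> (A \<inter> B) \<noteq> {}"
  shows "cond_pmf (cond_pmf P A) B = cond_pmf P (A \<inter> B)"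
proof (rule pmf_eqI)
  fix x
  have A: "set_pmf P \<inter> A \<noteq> {}" using assms by auto
  have B: "set_pmf (cond_pmf P A) \<inter> B \<noteq> {}" using assms by (auto simp: set_cond_pmf[OF A])
  have "measure (cond_pmf P A) B = measure P (A \<inter> B) / measure P A"
    unfolding cond_pmf.rep_eq[OF A]
    using measure_measure_pmf_not_zero[OF A] emeasure_measure_pmf_not_zero[OF A]
    by (subst measure_uniform_measure) auto
  moreover have "measure P A \<noteq> 0" "measure P (A \<inter> B) \<noteq> 0"
    using measure_measure_pmf_not_zero[OF A] measure_measure_pmf_not_zero[OF assms] by auto
  ultimately show "pmf (cond_pmf (cond_pmf P A) B) x = pmf (cond_pmf P (A \<inter> B)) x"
    by (simp add: pmf_cond[OF A] pmf_cond[OF B] pmf_cond[OF assms])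
qed

fun play :: "('s history \<Rightarrow> 's set \<Rightarrow> 's option) \<Rightarrow> 's history \<Rightarrow> 's set list \<Rightarrow> 's history" where
  "play D h [] = h"
| "play D h (N # Ns) = play D (h @ [(N, legal_choice h N (D h N))]) Ns"

text \<open>The histories that a player following \<open>D\<close> can produce. Decisions are
  compared after legalisation, the form in which a history records them.\<close>

definition consistent :: "('s history \<Rightarrow> 's set \<Rightarrow> 's option) \<Rightarrow> 's history \<Rightarrow> bool" where
  "consistent D h \<longleftrightarrow> (\<forall>h1 N c h2. h = h1 @ (N, c) # h2 \<longrightarrow> c = legal_choice h1 N (D h1 N))"

text \<open>Where no strategy in the support is consistent with \<open>h\<close>,
  \<open>cond_pmf\<close> is unspecified, but a run started in the empty history never gets there.
  Legalising here makes the later legalisation in \<open>run_from\<close> the identity.\<close>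

definition behaviour :: "'r pmf \<Rightarrow> ('r \<Rightarrow> 's history \<Rightarrow> 's set \<Rightarrow> 's option) \<Rightarrow>
    's history \<Rightarrow> 's set \<Rightarrow> 's option pmf" where
  "behaviour P D h N =
     map_pmf (\<lambda>r. legal_choice h N (D r h N)) (cond_pmf P {r. consistent (D r) h})"

lemma legal_choice_idem [simp]: "legal_choice h N (legal_choice h N c) = legal_choice h N c"
  by (auto simp: legal_choice_def split: option.splits)

lemma consistent_Nil [simp]: "consistent D []"
  by (simp add: consistent_def)

lemma consistent_snoc:
  "consistent D (h @ [(N, c)]) \<longleftrightarrow> consistent D h \<and> c = legal_choice h N (D h N)"
proof -
  \<comment> \<open>A split of the longer history marks either its last entry or an entry of
    \<open>h\<close>.\<close>
  have "h @ [(N, c)] = h1 @ (N', c') # h2 \<longleftrightarrow>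
      h1 = h \<and> N' = N \<and> c' = c \<and> h2 = [] \<or> (\<exists>h3. h2 = h3 @ [(N, c)] \<and> h = h1 @ (N', c') # h3)"
    for h1 N' c' h2
  proof (cases h2 rule: rev_cases)
    case (snoc h3 x)
    have "h @ [(N, c)] = h1 @ (N', c') # h3 @ [x] \<longleftrightarrow> h @ [(N, c)] = (h1 @ (N', c') # h3) @ [x]"
      by simp
    then show ?thesis unfolding snoc append1_eq_conv by auto
  qed auto
  then show ?thesis unfolding consistent_def by auto
qed

text \<open>Kuhn's theorem: a lottery over deterministic strategies is realised by drawing every
  decision from the lottery conditioned on the decisions already taken.\<close>
lemma run_from_behaviour:
  assumes A: "A S w = behaviour P D"
    and "set_pmf P \<inter> {r. consistent (D r) h} \<noteq> {}"
  shows "run_from A S w h Ns = map_pmf (\<lambda>r. play (D r) h Ns) (cond_pmf P {r. consistent (D r) h})"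
  using assms(2)
proof (induction Ns arbitrary: h)
  case Nil
  then show ?case by (simp add: map_pmf_const)
next
  case (Cons N Ns)
  let ?Q = "cond_pmf P {r. consistent (D r) h}"
  let ?g = "\<lambda>r. legal_choice h N (D r h N)"
  have *: "run_from A S w (h @ [(N, legal_choice h N c)]) Ns =
      map_pmf (\<lambda>r. play (D r) (h @ [(N, c)]) Ns) (cond_pmf ?Q {r. ?g r = c})"
    if c: "c \<in> set_pmf (map_pmf ?g ?Q)" for c
  proof -
    from c Cons.prems obtain r where r: "r \<in> set_pmf P" "consistent (D r) h" "c = ?g r"
      by (auto simp: set_cond_pmf)
    \<comment> \<open>Observing the decision \<open>c\<close> amounts to one further conditioning,
      so the induction hypothesis speaks about the lottery conditioned twice.\<close>
    have eq: "{r. consistent (D r) (h @ [(N, c)])} = {r. consistent (D r) h} \<inter> {r. ?g r = c}"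
      by (auto simp: consistent_snoc)
    have ne: "set_pmf P \<inter> ({r. consistent (D r) h} \<inter> {r. ?g r = c}) \<noteq> {}"
      using r by auto
    have "legal_choice h N c = c" using r by simp
    then show ?thesis
      using Cons.IH[of "h @ [(N, c)]"] ne by (simp add: eq cond_cond_pmf)
  qed
  have "run_from A S w h (N # Ns) =
      bind_pmf (map_pmf ?g ?Q) (\<lambda>c. run_from A S w (h @ [(N, legal_choice h N c)]) Ns)"
    by (simp add: A behaviour_def)
  also have "\<dots> = bind_pmf (map_pmf ?g ?Q)
      (\<lambda>c. map_pmf (\<lambda>r. play (D r) (h @ [(N, c)]) Ns) (cond_pmf ?Q {r. ?g r = c}))"
    by (intro bind_pmf_cong refl *)
  also have "\<dots> = map_pmf (\<lambda>r. play (D r) (h @ [(N, ?g r)]) Ns) ?Q"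
    by (rule bind_map_cond_pmf)
  finally show ?case by simp
qed

lemma run_alg_behaviour:
  assumes "A S w = behaviour P D"
  shows "run_alg A S w Ns = map_pmf (\<lambda>r. play (D r) [] Ns) P"
proof -
  have "cond_pmf P UNIV = P"
    by (rule pmf_eqI) (simp add: pmf_cond set_pmf_not_empty)
  then show ?thesis
    using run_from_behaviour[where A = A and S = S and w = w and P = P and D = D and h = "[]", OF assms] by (simp add: run_alg_def set_pmf_not_empty)
qed

section \<open>McDiarmid's inequality\<close>

lemma finite_set_Pi_pmf:
  assumes "finite I" "\<And>i. i \<in> I \<Longrightarrow> finite (set_pmf (p i))"
  shows "finite (set_pmf (Pi_pmf I d p))"
  using assms by (auto simp: set_Pi_pmf)

text \<open>Fubini for a single coordinate, with the new coordinate innermost; finite supports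
  settle integrability. It serves both the induction behind McDiarmid's inequality and the averaging
  over one rank.\<close>

lemma expectation_Pi_pmf_insert:
  fixes F :: "_ \<Rightarrow> real"
  assumes "finite I" "x \<notin> I" "\<And>i. i \<in> insert x I \<Longrightarrow> finite (set_pmf (p i))"
  shows "measure_pmf.expectation (Pi_pmf (insert x I) d p) F =
    measure_pmf.expectation (Pi_pmf I d p)
      (\<lambda>\<sigma>. measure_pmf.expectation (p x) (\<lambda>y. F (\<sigma>(x := y))))"
proof -
  have "Pi_pmf (insert x I) d p = bind_pmf (Pi_pmf I d p) (\<lambda>\<sigma>. map_pmf (\<lambda>y. \<sigma>(x := y)) (p x))"
    using assms by (simp add: Pi_pmf_insert' map_pmf_def bind_commute_pmf[of "p x"])
  then show ?thesis
    using assms finite_set_Pi_pmf[of I p d]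
    by (simp add: pmf_expectation_bind[where A = "set_pmf (Pi_pmf I d p)"]
        integral_measure_pmf[where A = "set_pmf (Pi_pmf I d p)"])
qed

text \<open>Hoeffding's lemma in oscillation form: the interval is spanned by the minimum and
  maximum of \<open>f\<close> on the finite support, and a constant factor undoes the
  centring.\<close>

lemma Hoeffdings_lemma_pmf:
  fixes f :: "'a \<Rightarrow> real"
  assumes fin: "finite (set_pmf p)" and "l > 0"
    and c: "\<And>x y. x \<in> set_pmf p \<Longrightarrow> y \<in> set_pmf p \<Longrightarrow> \<bar>f x - f y\<bar> \<le> c"
  shows "measure_pmf.expectation p (\<lambda>x. exp (l * f x)) \<le>
    exp (l * measure_pmf.expectation p f + l\<^sup>2 * c\<^sup>2 / 8)"
proof -
  let ?a = "Min (f ` set_pmf p)" and ?b = "Max (f ` set_pmf p)"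
  let ?E = "measure_pmf.expectation p f"
  interpret interval_bounded_random_variable "measure_pmf p" f ?a ?b
    by unfold_locales (auto simp: AE_measure_pmf_iff fin)
  have int: "integrable (measure_pmf p) g" for g :: "'a \<Rightarrow> real"
    by (rule integrable_measure_pmf_finite[OF fin])
  have "?b \<in> f ` set_pmf p" "?a \<in> f ` set_pmf p"
    using fin by (intro Max_in Min_in; simp add: set_pmf_not_empty)+
  then have "\<bar>?b - ?a\<bar> \<le> c" using c by auto
  then have bc: "(?b - ?a)\<^sup>2 \<le> c\<^sup>2" by (metis abs_ge_zero power2_abs power_mono)
  have "ennreal (measure_pmf.expectation p (\<lambda>x. exp (l * (f x - ?E)))) \<le> exp (l\<^sup>2 * (?b - ?a)\<^sup>2 / 8)"
    using Hoeffdings_lemma_nn_integral[OF \<open>l > 0\<close>] int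
    by (subst nn_integral_eq_integral[symmetric]) simp_all
  then have "measure_pmf.expectation p (\<lambda>x. exp (l * (f x - ?E))) \<le> exp (l\<^sup>2 * (?b - ?a)\<^sup>2 / 8)"
    by simp
  also have "\<dots> \<le> exp (l\<^sup>2 * c\<^sup>2 / 8)"
    using bc by (simp add: mult_left_mono)
  finally have "exp (l * ?E) * measure_pmf.expectation p (\<lambda>x. exp (l * (f x - ?E))) \<le>
      exp (l * ?E) * exp (l\<^sup>2 * c\<^sup>2 / 8)"
    by simp
  moreover have "exp (l * f x) = exp (l * ?E) * exp (l * (f x - ?E))" for x
    by (simp add: right_diff_distrib flip: exp_add)
  ultimately show ?thesis by (simp add: exp_add)
qed

text \<open>Induction on coordinates takes the place of a martingale argument: integrating out
  \<open>x\<close> keeps the difference bounds of the others, and Hoeffding's lemma charges the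
  factor \<open>exp (l\<^sup>2 * (c x)\<^sup>2 / 8)\<close> for it.\<close>

lemma expectation_exp_bounded_differences:
  fixes F :: "('i \<Rightarrow> 'a) \<Rightarrow> real"
  assumes "finite I" "l > 0" "\<And>i. i \<in> I \<Longrightarrow> finite (set_pmf (p i))"
    and "\<And>i \<sigma> r. i \<in> I \<Longrightarrow> \<sigma> \<in> set_pmf (Pi_pmf I d p) \<Longrightarrow> r \<in> set_pmf (p i) \<Longrightarrow>
      \<bar>F (\<sigma>(i := r)) - F \<sigma>\<bar> \<le> c i"
  shows "measure_pmf.expectation (Pi_pmf I d p) (\<lambda>\<sigma>. exp (l * F \<sigma>)) \<le>
    exp (l * measure_pmf.expectation (Pi_pmf I d p) F + l\<^sup>2 * (\<Sum>i\<in>I. (c i)\<^sup>2) / 8)"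
  using assms
proof (induction I arbitrary: F rule: finite_induct)
  case empty
  then show ?case by simp
next
  case (insert x I)
  let ?P = "Pi_pmf I d p" and ?K = "\<Sum>i\<in>I. (c i)\<^sup>2"
  define G where "G = (\<lambda>\<sigma>. measure_pmf.expectation (p x) (\<lambda>y. F (\<sigma>(x := y))))"
  have fin: "finite (set_pmf ?P)" "finite (set_pmf (p x))"
    using insert by (auto intro!: finite_set_Pi_pmf)
  have int: "integrable (measure_pmf ?P) g" "integrable (measure_pmf (p x)) g'"
    for g :: "_ \<Rightarrow> real" and g' :: "_ \<Rightarrow> real"
    using fin by (auto intro: integrable_measure_pmf_finite)
  have upd: "\<sigma>(x := y) \<in> set_pmf (Pi_pmf (insert x I) d p)"
    if "\<sigma> \<in> set_pmf ?P" "y \<in> set_pmf (p x)" for \<sigma> y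
    using that insert.hyps by (auto simp: set_Pi_pmf PiE_dflt_def)
  \<comment> \<open>Averaging over coordinate \<open>x\<close> preserves the bounds, because updates
    at \<open>i\<close> and at \<open>x\<close> commute.\<close>
  have G_diff: "\<bar>G (\<sigma>(i := r)) - G \<sigma>\<bar> \<le> c i"
    if i: "i \<in> I" and \<sigma>: "\<sigma> \<in> set_pmf ?P" and r: "r \<in> set_pmf (p i)" for i \<sigma> r
  proof -
    have "i \<noteq> x" using i insert.hyps by auto
    have "\<bar>G (\<sigma>(i := r)) - G \<sigma>\<bar> =
        \<bar>measure_pmf.expectation (p x) (\<lambda>y. F (\<sigma>(i := r, x := y)) - F (\<sigma>(x := y)))\<bar>"
      unfolding G_def using int by (subst Bochner_Integration.integral_diff) auto
    also have "\<dots> \<le> measure_pmf.expectation (p x) (\<lambda>y. \<bar>F (\<sigma>(i := r, x := y)) - F (\<sigma>(x := y))\<bar>)"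
      by (rule integral_abs_bound)
    also have "\<dots> \<le> measure_pmf.expectation (p x) (\<lambda>y. c i)"
    proof (rule integral_mono_AE)
      have "\<bar>F (\<sigma>(i := r, x := y)) - F (\<sigma>(x := y))\<bar> \<le> c i" if y: "y \<in> set_pmf (p x)" for y
        using insert.prems(3)[of i "\<sigma>(x := y)" r] upd[OF \<sigma> y] i r
        by (simp add: fun_upd_twist[OF \<open>i \<noteq> x\<close>] del: fun_upd_apply)
      then show "AE y in measure_pmf (p x). \<bar>F (\<sigma>(i := r, x := y)) - F (\<sigma>(x := y))\<bar> \<le> c i"
        by (simp add: AE_measure_pmf_iff)
    qed (use int in auto)
    finally show ?thesis by simp
  qed
  have "measure_pmf.expectation (Pi_pmf (insert x I) d p) (\<lambda>\<sigma>. exp (l * F \<sigma>)) =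
      measure_pmf.expectation ?P (\<lambda>\<sigma>. measure_pmf.expectation (p x) (\<lambda>y. exp (l * F (\<sigma>(x := y)))))"
    using insert by (intro expectation_Pi_pmf_insert) auto
  also have "\<dots> \<le> measure_pmf.expectation ?P (\<lambda>\<sigma>. exp (l\<^sup>2 * (c x)\<^sup>2 / 8) * exp (l * G \<sigma>))"
  proof (rule integral_mono_AE)
    have "measure_pmf.expectation (p x) (\<lambda>y. exp (l * F (\<sigma>(x := y)))) \<le>
        exp (l\<^sup>2 * (c x)\<^sup>2 / 8) * exp (l * G \<sigma>)" if "\<sigma> \<in> set_pmf ?P" for \<sigma>
    proof -
      \<comment> \<open>All coordinates but \<open>x\<close> are frozen; the assumption is applied
        at the point whose \<open>x\<close> coordinate is already \<open>z\<close>.\<close>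
      have "\<bar>F (\<sigma>(x := y)) - F (\<sigma>(x := z))\<bar> \<le> c x"
        if "y \<in> set_pmf (p x)" "z \<in> set_pmf (p x)" for y z
        using insert.prems(3)[of x "\<sigma>(x := z)" y] upd[OF \<open>\<sigma> \<in> _\<close> that(2)] that
        by (simp del: fun_upd_apply)
      from Hoeffdings_lemma_pmf[OF fin(2) \<open>l > 0\<close> this]
      show ?thesis by (simp add: G_def exp_add mult.commute)
    qed
    then show "AE \<sigma> in measure_pmf ?P. measure_pmf.expectation (p x) (\<lambda>y. exp (l * F (\<sigma>(x := y)))) \<le>
        exp (l\<^sup>2 * (c x)\<^sup>2 / 8) * exp (l * G \<sigma>)"
      by (simp add: AE_measure_pmf_iff)
  qed (use int in auto)
  also have "\<dots> = exp (l\<^sup>2 * (c x)\<^sup>2 / 8) * measure_pmf.expectation ?P (\<lambda>\<sigma>. exp (l * G \<sigma>))"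
    by simp
  also have "\<dots> \<le> exp (l\<^sup>2 * (c x)\<^sup>2 / 8) * exp (l * measure_pmf.expectation ?P G + l\<^sup>2 * ?K / 8)"
    using insert.prems(2) by (intro mult_left_mono insert.IH[OF insert.prems(1) _ G_diff]) auto
  also have "\<dots> = exp (l * measure_pmf.expectation ?P G + l\<^sup>2 * (\<Sum>i\<in>insert x I. (c i)\<^sup>2) / 8)"
    using insert.hyps by (simp add: algebra_simps add_divide_distrib flip: exp_add)
  also have "measure_pmf.expectation ?P G = measure_pmf.expectation (Pi_pmf (insert x I) d p) F"
    unfolding G_def using insert by (intro expectation_Pi_pmf_insert[symmetric]) auto
  finally show ?case .
qed

text \<open>Chernoff's method applied to \<open>- F\<close>.\<close>

theorem McDiarmid_lower_tail:
  fixes F :: "('i \<Rightarrow> 'a) \<Rightarrow> real"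
  assumes "finite I" "\<And>i. i \<in> I \<Longrightarrow> finite (set_pmf (p i))"
    and diff: "\<And>i \<sigma> r. i \<in> I \<Longrightarrow> \<sigma> \<in> set_pmf (Pi_pmf I d p) \<Longrightarrow> r \<in> set_pmf (p i) \<Longrightarrow>
      \<bar>F (\<sigma>(i := r)) - F \<sigma>\<bar> \<le> c i"
    and C: "(\<Sum>i\<in>I. (c i)\<^sup>2) > 0" and t: "t > 0"
  shows "measure_pmf.prob (Pi_pmf I d p) {\<sigma>. F \<sigma> \<le> measure_pmf.expectation (Pi_pmf I d p) F - t} \<le>
    exp (- 2 * t\<^sup>2 / (\<Sum>i\<in>I. (c i)\<^sup>2))"
proof -
  let ?P = "Pi_pmf I d p" and ?C = "\<Sum>i\<in>I. (c i)\<^sup>2"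
  let ?E = "measure_pmf.expectation ?P F"
  \<comment> \<open>The minimiser of \<open>- l * t + l\<^sup>2 * ?C / 8\<close>.\<close>
  define l where "l = 4 * t / ?C"
  have l: "l > 0" using C t by (simp add: l_def)
  have fin: "finite (set_pmf ?P)" using assms by (intro finite_set_Pi_pmf)
  have int: "integrable (measure_pmf ?P) g" for g :: "_ \<Rightarrow> real"
    by (rule integrable_measure_pmf_finite[OF fin])
  have "measure_pmf.prob ?P {\<sigma>. F \<sigma> \<le> ?E - t} =
      measure_pmf.expectation ?P (indicator {\<sigma>. F \<sigma> \<le> ?E - t})"
    by simp
  \<comment> \<open>Markov's inequality in pointwise form: on the event the total exponent is
    nonnegative.\<close>
  also have "\<dots> \<le> measure_pmf.expectation ?P (\<lambda>\<sigma>. exp (l * (?E - t)) * exp (l * - F \<sigma>))"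
    using l by (intro integral_mono int) (auto simp: indicator_def simp flip: exp_add)
  also have "\<dots> = exp (l * (?E - t)) * measure_pmf.expectation ?P (\<lambda>\<sigma>. exp (l * - F \<sigma>))"
    by simp
  also have "\<dots> \<le> exp (l * (?E - t)) *
      exp (l * measure_pmf.expectation ?P (\<lambda>\<sigma>. - F \<sigma>) + l\<^sup>2 * ?C / 8)"
  proof (intro mult_left_mono expectation_exp_bounded_differences)
    fix i \<sigma> r assume "i \<in> I" "\<sigma> \<in> set_pmf ?P" "r \<in> set_pmf (p i)"
    from diff[OF this] show "\<bar>- F (\<sigma>(i := r)) - - F \<sigma>\<bar> \<le> c i" by linarith
  qed (use assms l in auto)
  also have "\<dots> = exp (- l * t + l\<^sup>2 * ?C / 8)"
    by (simp add: right_diff_distrib flip: exp_add)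
  also have "- l * t + l\<^sup>2 * ?C / 8 = - 2 * t\<^sup>2 / ?C"
    using C by (simp add: l_def field_simps power2_eq_square)
  finally show ?thesis .
qed

section \<open>Greedy matching by scores\<close>

text \<open>Scores can tie; a numbering \<open>e\<close> that is injective on the vertices turns the
  comparison into a strict total order.\<close>

definition beats :: "('s \<Rightarrow> real) \<Rightarrow> ('s \<Rightarrow> nat) \<Rightarrow> 's \<Rightarrow> 's \<Rightarrow> bool" where
  "beats sc e a b \<longleftrightarrow> sc b < sc a \<or> sc a = sc b \<and> e a < e b"

definition top_choice :: "('s \<Rightarrow> real) \<Rightarrow> ('s \<Rightarrow> nat) \<Rightarrow> 's set \<Rightarrow> 's option" where
  "top_choice sc e X =
     (if X = {} then None else Some (THE a. a \<in> X \<and> (\<forall>b\<in>X. b = a \<or> beats sc e a b)))"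

text \<open>The value 0 for the empty set is the utility of an online vertex that stays
  unmatched.\<close>

definition top_score :: "('s \<Rightarrow> real) \<Rightarrow> 's set \<Rightarrow> real" where
  "top_score sc X = (if X = {} then 0 else Max (sc ` X))"

text \<open>Only the free offline vertices are tracked; the initial set is an argument, so that runs
  with and without a given vertex can be compared.\<close>

fun remaining :: "('s \<Rightarrow> real) \<Rightarrow> ('s \<Rightarrow> nat) \<Rightarrow> 's set \<Rightarrow> 's set list \<Rightarrow> 's set" where
  "remaining sc e X [] = X"
| "remaining sc e X (N # Ns) = remaining sc e (X - set_option (top_choice sc e (X \<inter> N))) Ns"

lemma top_choice_empty [simp]: "top_choice sc e {} = None"
  by (simp add: top_choice_def)

lemma beats_asym: "beats sc e a b \<Longrightarrow> \<not> beats sc e b a"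
  by (auto simp: beats_def)

lemma beats_trans: "beats sc e a b \<Longrightarrow> beats sc e b c \<Longrightarrow> beats sc e a c"
  by (auto simp: beats_def)

lemma beats_total: "inj_on e X \<Longrightarrow> a \<in> X \<Longrightarrow> b \<in> X \<Longrightarrow> b = a \<or> beats sc e a b \<or> beats sc e b a"
  unfolding beats_def inj_on_def by (metis linorder_less_linear)

lemma top_choice_eqI:
  assumes "a \<in> X" "\<And>b. b \<in> X \<Longrightarrow> b = a \<or> beats sc e a b"
  shows "top_choice sc e X = Some a"
proof -
  have "(THE a. a \<in> X \<and> (\<forall>b\<in>X. b = a \<or> beats sc e a b)) = a"
  proof (rule the_equality)
    fix a' assume a': "a' \<in> X \<and> (\<forall>b\<in>X. b = a' \<or> beats sc e a' b)"
    then show "a' = a" using assms(1) assms(2)[of a'] beats_asym[of sc e a a'] by auto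
  qed (use assms in auto)
  then show ?thesis
    using assms(1) by (auto simp: top_choice_def)
qed

lemma top_choice_obtain:
  assumes "finite X" "inj_on e X" "X \<noteq> {}"
  obtains a where "top_choice sc e X = Some a" "a \<in> X"
    "\<And>b. b \<in> X \<Longrightarrow> b = a \<or> beats sc e a b"
proof -
  have "\<exists>a\<in>X. \<forall>b\<in>X. b = a \<or> beats sc e a b"
    using assms(1,3,2)
  proof (induction X rule: finite_ne_induct)
    case (singleton x)
    then show ?case by auto
  next
    case (insert x F)
    then obtain a where a: "a \<in> F" "\<forall>b\<in>F. b = a \<or> beats sc e a b" by auto
    consider "beats sc e a x" | "beats sc e x a"
      using beats_total[OF insert.prems, of a x] a(1) insert.hyps(3) by auto
    then show ?case
    proof cases
      case 1
      then show ?thesis using a by blast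
    next
      case 2
      then have "\<forall>b\<in>insert x F. b = x \<or> beats sc e x b"
        using a(2) beats_trans[OF 2] 2 by (metis insertE)
      then show ?thesis by blast
    qed
  qed
  then show ?thesis
    using that top_choice_eqI by metis
qed

lemma top_choice_mem:
  assumes "finite X" "inj_on e X" "top_choice sc e X = Some a"
  shows "a \<in> X"
  by (metis assms option.distinct(1) option.inject top_choice_empty top_choice_obtain)

lemma top_score_ge: "finite X \<Longrightarrow> a \<in> X \<Longrightarrow> sc a \<le> top_score sc X"
  by (auto simp: top_score_def)

lemma top_score_nonneg:
  assumes "finite X" "\<And>j. j \<in> X \<Longrightarrow> 0 \<le> sc j"
  shows "0 \<le> top_score sc X"
proof (cases "X = {}")
  case False
  then obtain a where "a \<in> X" by blast
  then show ?thesis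
    using assms top_score_ge[of X a sc] by force
qed (simp add: top_score_def)

lemma top_score_mono:
  assumes "finite Y" "X \<subseteq> Y" "\<And>j. j \<in> Y \<Longrightarrow> 0 \<le> sc j"
  shows "top_score sc X \<le> top_score sc Y"
proof (cases "X = {}")
  case True
  then show ?thesis using top_score_nonneg[of Y sc] assms by (simp add: top_score_def)
next
  case False
  then show ?thesis
    using assms by (auto simp: top_score_def intro!: Max_mono)
qed

lemma top_choice_score:
  assumes "finite X" "inj_on e X" "top_choice sc e X = Some a"
  shows "top_score sc X = sc a"
proof -
  have "X \<noteq> {}" using assms(3) by auto
  then obtain a' where a': "top_choice sc e X = Some a'" "a' \<in> X"
    "\<And>b. b \<in> X \<Longrightarrow> b = a' \<or> beats sc e a' b"
    using top_choice_obtain assms by metis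
  have "Max (sc ` X) = sc a'"
    using a' assms(1) by (intro Max_eqI) (fastforce simp: beats_def)+
  then show ?thesis
    using a' assms(3) \<open>X \<noteq> {}\<close> by (simp add: top_score_def)
qed

lemma remaining_subset: "remaining sc e X Ns \<subseteq> X"
  by (induction Ns arbitrary: X) fastforce+

lemma remaining_append: "remaining sc e X (Ns @ Ms) = remaining sc e (remaining sc e X Ns) Ms"
  by (induction Ns arbitrary: X) auto

lemma top_choice_cong:
  assumes "\<And>j. j \<in> X \<Longrightarrow> sc j = sc' j"
  shows "top_choice sc e X = top_choice sc' e X"
proof -
  have "(a \<in> X \<and> (\<forall>b\<in>X. b = a \<or> beats sc e a b)) \<longleftrightarrow> (a \<in> X \<and> (\<forall>b\<in>X. b = a \<or> beats sc' e a b))" for a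
    using assms by (auto simp: beats_def)
  then show ?thesis by (simp add: top_choice_def)
qed

text \<open>Meant for the set \<open>S - {j}\<close>: a run without \<open>j\<close> is blind to the
  rank of \<open>j\<close>.\<close>

lemma remaining_cong:
  assumes "\<And>j. j \<in> X \<Longrightarrow> sc j = sc' j"
  shows "remaining sc e X Ns = remaining sc' e X Ns"
  using assms
proof (induction Ns arbitrary: X)
  case (Cons N Ns)
  have "top_choice sc e (X \<inter> N) = top_choice sc' e (X \<inter> N)"
    using Cons.prems by (intro top_choice_cong) auto
  then show ?case
    using Cons.IH[of "X - set_option (top_choice sc' e (X \<inter> N))"] Cons.prems by simp
qed auto

text \<open>Following an alternating path: an additional offline vertex displaces, from one arrival to
  the next, at most one other vertex, and each displaced vertex has a lower score than the previous one.\<close>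
lemma remaining_insert:
  assumes "finite X" "inj_on e (insert x X)" "x \<notin> X"
  shows "remaining sc e (insert x X) Ns = remaining sc e X Ns \<or>
    (\<exists>y. y \<in> insert x X \<and> y \<notin> remaining sc e X Ns \<and> sc y \<le> sc x \<and>
       remaining sc e (insert x X) Ns = insert y (remaining sc e X Ns))"
  using assms
proof (induction Ns arbitrary: x X)
  case (Cons N Ns)
  note fin = Cons.prems(1) and inj = Cons.prems(2) and x = Cons.prems(3)
  have inj': "inj_on e Y" if "Y \<subseteq> insert x X" for Y
    using inj inj_on_subset that by blast
  consider "x \<notin> N" | "x \<in> N" "X \<inter> N = {}" | "x \<in> N" "X \<inter> N \<noteq> {}" by blast
  then show ?case
  proof cases
    case 1
    let ?C = "set_option (top_choice sc e (X \<inter> N))"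
    have C: "?C \<subseteq> X"
      using top_choice_mem[of "X \<inter> N" e sc] fin inj'[of "X \<inter> N"] by (auto simp: subset_iff)
    have "insert x X \<inter> N = X \<inter> N" using 1 by auto
    moreover have "insert x X - ?C = insert x (X - ?C)" using x C by auto
    ultimately have "remaining sc e (insert x X) (N # Ns) = remaining sc e (insert x (X - ?C)) Ns"
      by simp
    then show ?thesis
      using Cons.IH[of "X - ?C" x] fin x inj'[of "insert x (X - ?C)"] by auto
  next
    \<comment> \<open>Only the larger run can serve this arrival; it takes \<open>x\<close>, and the
      two runs coincide from then on.\<close>
    case 2
    have "insert x X \<inter> N = {x}" using 2 by auto
    moreover have "top_choice sc e {x} = Some x" by (rule top_choice_eqI) auto
    ultimately show ?thesis using 2 x by simp
  next
    case 3
    have eq: "insert x X \<inter> N = insert x (X \<inter> N)" using 3 by auto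
    obtain y where y: "top_choice sc e (X \<inter> N) = Some y" "y \<in> X \<inter> N"
        "\<And>b. b \<in> X \<inter> N \<Longrightarrow> b = y \<or> beats sc e y b"
      using top_choice_obtain[of "X \<inter> N" e sc] fin 3 inj'[of "X \<inter> N"] by auto
    have "x \<noteq> y" using x y by auto
    with beats_total[OF inj, of x y sc] y consider "beats sc e x y" | "beats sc e y x" by auto
    then show ?thesis
    proof cases
      \<comment> \<open>\<open>x\<close> is taken instead of \<open>y\<close>, so \<open>y\<close>
        becomes the surplus vertex and the induction hypothesis is used for it.\<close>
      case 1
      have "b = x \<or> beats sc e x b" if "b \<in> insert x (X \<inter> N)" for b
        using that y(3)[of b] 1 beats_trans[OF 1, of b] by auto
      then have "top_choice sc e (insert x X \<inter> N) = Some x"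
        unfolding eq by (intro top_choice_eqI) auto
      then have L: "remaining sc e (insert x X) (N # Ns) = remaining sc e X Ns"
        using x by simp
      have R: "remaining sc e X (N # Ns) = remaining sc e (X - {y}) Ns"
        using y by simp
      have yx: "sc y \<le> sc x" using 1 by (auto simp: beats_def)
      have X: "insert y (X - {y}) = X" using y by auto
      have "remaining sc e X Ns = remaining sc e (X - {y}) Ns \<or>
          (\<exists>z. z \<in> X \<and> z \<notin> remaining sc e (X - {y}) Ns \<and> sc z \<le> sc y \<and>
            remaining sc e X Ns = insert z (remaining sc e (X - {y}) Ns))"
        using Cons.IH[of "X - {y}" y] fin inj'[of X] unfolding X by blast
      then show ?thesis
        unfolding L R using yx by (meson insertCI order_trans)
    next
      \<comment> \<open>Both runs take \<open>y\<close>, and \<open>x\<close> stays the surplus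
        vertex.\<close>
      case 2
      have "top_choice sc e (insert x X \<inter> N) = Some y"
        unfolding eq using y 2 by (intro top_choice_eqI) auto
      then have L: "remaining sc e (insert x X) (N # Ns) = remaining sc e (insert x (X - {y})) Ns"
        using \<open>x \<noteq> y\<close> by (simp add: insert_Diff_if)
      have R: "remaining sc e X (N # Ns) = remaining sc e (X - {y}) Ns"
        using y by simp
      show ?thesis
        unfolding L R using Cons.IH[of "X - {y}" x] fin x inj'[of "insert x (X - {y})"] by blast
    qed
  qed
qed auto

lemma remaining_insert_supset:
  assumes "finite X" "inj_on e (insert x X)" "x \<notin> X"
  shows "remaining sc e X Ns \<subseteq> remaining sc e (insert x X) Ns"
  using remaining_insert[OF assms, of sc Ns] by auto

lemma remaining_take_antimono: "remaining sc e X Ns \<subseteq> remaining sc e X (take i Ns)"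
  by (metis append_take_drop_id remaining_append remaining_subset)

text \<open>A vertex that stays free to the end was free when its neighbour \<open>i\<close>
  arrived, so \<open>i\<close> preferred another vertex. The two runs then differ by
  \<open>x\<close> alone, so that vertex is free in the run without \<open>x\<close> as
  well.\<close>

lemma score_le_if_remaining:
  assumes "finite X" "inj_on e (insert x X)" "x \<notin> X"
    and left: "x \<in> remaining sc e (insert x X) Ns"
    and i: "i < length Ns" "x \<in> Ns ! i"
  shows "sc x \<le> top_score sc (remaining sc e X (take i Ns) \<inter> Ns ! i)"
proof -
  let ?A = "remaining sc e (insert x X) (take i Ns)"
  let ?B = "remaining sc e X (take i Ns)"
  have xA: "x \<in> remaining sc e (insert x X) (take (Suc i) Ns)"
    using left remaining_take_antimono[of sc e "insert x X" Ns "Suc i"] by blast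
  then have xA': "x \<in> ?A - set_option (top_choice sc e (?A \<inter> Ns ! i))"
    using i by (simp add: take_Suc_conv_app_nth remaining_append)
  have "x \<notin> ?B"
    using assms(3) remaining_subset[of sc e X] by blast
  then have A: "?A = insert x ?B"
    using remaining_insert[OF assms(1-3), of sc "take i Ns"] xA' by auto
  have fin: "finite (?A \<inter> Ns ! i)"
    using assms(1) finite_subset[OF remaining_subset] by blast
  have inj: "inj_on e (?A \<inter> Ns ! i)"
    using remaining_subset[of sc e "insert x X" "take i Ns"]
    by (intro inj_on_subset[OF assms(2)]) auto
  have ne: "?A \<inter> Ns ! i \<noteq> {}" using xA' i by auto
  obtain y where y: "top_choice sc e (?A \<inter> Ns ! i) = Some y" "y \<in> ?A \<inter> Ns ! i"
      "\<And>b. b \<in> ?A \<inter> Ns ! i \<Longrightarrow> b = y \<or> beats sc e y b"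
    by (rule top_choice_obtain[OF fin inj ne, of sc]) (rule that)
  have "y \<noteq> x" using xA' y by auto
  then have "beats sc e y x" using y(3)[of x] xA' i by simp
  then have "sc x \<le> sc y" unfolding beats_def by linarith
  also have "sc y \<le> top_score sc (?B \<inter> Ns ! i)"
    using y \<open>y \<noteq> x\<close> A finite_subset[OF remaining_subset assms(1)] by (intro top_score_ge) auto
  finally show ?thesis .
qed

text \<open>Each arrival contributes the score of the vertex it takes, and every vertex leaves the
  free set at most once.\<close>

lemma sum_top_score:
  assumes "finite X" "inj_on e X"
  shows "(\<Sum>i<length Ns. top_score sc (remaining sc e X (take i Ns) \<inter> Ns ! i)) =
    (\<Sum>j\<in>X - remaining sc e X Ns. sc j)"
  using assms
proof (induction Ns rule: rev_induct)
  case (snoc N Ns)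
  let ?R = "remaining sc e X Ns"
  have fin: "finite ?R" using snoc.prems finite_subset[OF remaining_subset] by blast
  have "?R \<inter> N \<subseteq> X" using remaining_subset[of sc e X Ns] by auto
  then have inj: "inj_on e (?R \<inter> N)" by (rule inj_on_subset[OF snoc.prems(2)])
  have "(\<Sum>i<length Ns. top_score sc (remaining sc e X (take i (Ns @ [N])) \<inter> (Ns @ [N]) ! i)) =
      (\<Sum>i<length Ns. top_score sc (remaining sc e X (take i Ns) \<inter> Ns ! i))"
    by (intro sum.cong) (auto simp: nth_append)
  then have L: "(\<Sum>i<length (Ns @ [N]). top_score sc (remaining sc e X (take i (Ns @ [N])) \<inter> (Ns @ [N]) ! i)) =
      (\<Sum>j\<in>X - ?R. sc j) + top_score sc (?R \<inter> N)"
    using snoc by simp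
  show ?case
  proof (cases "?R \<inter> N = {}")
    case True
    then show ?thesis unfolding L by (simp add: remaining_append top_score_def)
  next
    case False
    then obtain y where y: "top_choice sc e (?R \<inter> N) = Some y" "y \<in> ?R \<inter> N"
      using top_choice_obtain[of "?R \<inter> N" e sc] fin inj by auto
    have "X - remaining sc e X (Ns @ [N]) = insert y (X - ?R)"
      using y remaining_subset[of sc e X Ns] by (auto simp: remaining_append)
    then show ?thesis unfolding L
      using y snoc.prems top_choice_score[OF _ inj y(1)] fin by simp
  qed
qed auto

section \<open>Ranking with truncated discounts\<close>

text \<open>A discretisation of the factor \<open>1 - (1 - \<delta>) * exp (y - 1)\<close> at \<open>y = r / k\<close>: powers of
  \<open>1 + 1 / k\<close> turn the integral equation behind the primal-dual analysis into an exact sum.\<close>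
definition discount :: "real \<Rightarrow> nat \<Rightarrow> nat \<Rightarrow> real" where
  "discount \<delta> k r = 1 - (1 - \<delta>) * ((1 + 1 / real k) ^ r / (1 + 1 / real k) ^ k)"

definition score :: "real \<Rightarrow> nat \<Rightarrow> ('s \<Rightarrow> real) \<Rightarrow> ('s \<Rightarrow> nat) \<Rightarrow> 's \<Rightarrow> real" where
  "score \<delta> k w \<sigma> j = w j * discount \<delta> k (\<sigma> j)"

text \<open>The drop of the discount from rank 0 to rank \<open>k\<close>; it tends to
  \<open>(1 - \<delta>) * (1 - 1 / exp 1)\<close> as \<open>k\<close> grows.\<close>

definition guarantee :: "real \<Rightarrow> nat \<Rightarrow> real" where
  "guarantee \<delta> k = (1 - \<delta>) * (1 - 1 / (1 + 1 / real k) ^ k)"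

lemma discount_le_1: "\<delta> \<le> 1 \<Longrightarrow> discount \<delta> k r \<le> 1"
  by (simp add: discount_def)

lemma discount_ge:
  assumes "\<delta> \<le> 1" "r \<le> k"
  shows "\<delta> \<le> discount \<delta> k r"
proof -
  have "(1 + 1 / real k) ^ r \<le> (1 + 1 / real k) ^ k"
    using assms(2) by (intro power_increasing) auto
  then have "(1 + 1 / real k) ^ r / (1 + 1 / real k) ^ k \<le> 1"
    by (intro divide_le_eq_1[THEN iffD2]) (simp add: add_pos_nonneg)
  then have "(1 - \<delta>) * ((1 + 1 / real k) ^ r / (1 + 1 / real k) ^ k) \<le> (1 - \<delta>) * 1"
    using assms(1) by (intro mult_left_mono) auto
  then show ?thesis by (simp add: discount_def)
qed

text \<open>Rank \<open>k\<close> is never drawn; it is the endpoint of the telescoping sum, where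
  the discount reaches its floor.\<close>

lemma discount_last: "discount \<delta> k k = \<delta>"
proof -
  have "1 + 1 / real k \<noteq> 0" using zero_le_divide_1_iff[of "real k"] by linarith
  then show ?thesis by (simp add: discount_def)
qed

text \<open>\<open>1 - discount\<close> is geometric with ratio \<open>1 + 1 / k\<close>, hence
  \<open>k\<close> times the next decrement of the discount: a discrete form of
  \<open>f' = f - 1\<close>.\<close>

lemma sum_discount:
  assumes "k > 0"
  shows "(\<Sum>r<m. 1 - discount \<delta> k r) = real k * (discount \<delta> k 0 - discount \<delta> k m)"
proof (induction m)
  case (Suc m)
  have "1 - discount \<delta> k (Suc m) = (1 - discount \<delta> k m) * (1 + 1 / real k)"
    by (simp add: discount_def)
  then have "real k * (discount \<delta> k m - discount \<delta> k (Suc m)) = 1 - discount \<delta> k m"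
    using assms by (simp add: field_simps)
  then show ?case using Suc by (simp add: algebra_simps)
qed simp

lemma discount_0_minus_last: "discount \<delta> k 0 - \<delta> = guarantee \<delta> k"
  by (simp add: discount_def guarantee_def algebra_simps)

text \<open>Below the first rank \<open>m\<close> with
  \<open>v * discount \<delta> k m \<le> u\<close> the revenue counts, and it telescopes to
  \<open>k * v\<close> times the drop of the discount up to \<open>m\<close>; the terms
  \<open>u\<close> cover the remaining \<open>v * discount \<delta> k m\<close>.\<close>

lemma sum_threshold_ge:
  assumes k: "k > 0" and \<delta>: "0 \<le> \<delta>" "\<delta> \<le> 1" and v: "0 \<le> v" and u: "0 \<le> u"
  shows "real k * (guarantee \<delta> k * v) \<le>
    (\<Sum>r<k. u + (if u < v * discount \<delta> k r then v * (1 - discount \<delta> k r) else 0))"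
proof -
  let ?f = "discount \<delta> k"
  define m where "m = (LEAST r. \<not> (r < k \<and> u < v * ?f r))"
  have m: "\<not> (m < k \<and> u < v * ?f m)"
    unfolding m_def by (rule LeastI[of _ k]) simp
  have below: "r < k \<and> u < v * ?f r" if "r < m" for r
    using not_less_Least[of r "\<lambda>r. \<not> (r < k \<and> u < v * ?f r)"] that by (auto simp: m_def)
  have "m \<le> k"
    using below[of k] by (meson less_irrefl not_le)
  have "guarantee \<delta> k * v \<le> u + v * (?f 0 - ?f m)"
  proof (cases "m = k")
    \<comment> \<open>No drawn rank brings the score down to \<open>u\<close>; what is missing is
      the floor \<open>\<delta>\<close>, which \<open>guarantee\<close> has already given
      up.\<close>
    case True
    then show ?thesis using u discount_0_minus_last[of \<delta> k] by (simp add: discount_last mult.commute)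
  next
    case False
    then have "v * ?f m \<le> u" using m \<open>m \<le> k\<close> by auto
    moreover have "guarantee \<delta> k * v \<le> ?f 0 * v"
      using v \<delta> discount_0_minus_last[of \<delta> k] by (intro mult_right_mono) auto
    ultimately show ?thesis by (simp add: algebra_simps)
  qed
  then have "real k * (guarantee \<delta> k * v) \<le> real k * (u + v * (?f 0 - ?f m))"
    by (intro mult_left_mono) auto
  also have "\<dots> = real k * u + v * (\<Sum>r<m. 1 - ?f r)"
    using k by (simp add: sum_discount algebra_simps)
  also have "\<dots> = (\<Sum>r<k. u) + (\<Sum>r<m. v * (1 - ?f r))"
    by (simp add: sum_distrib_left)
  also have "(\<Sum>r<m. v * (1 - ?f r)) = (\<Sum>r<m. if u < v * ?f r then v * (1 - ?f r) else 0)"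
    using below by (intro sum.cong) auto
  also have "\<dots> \<le> (\<Sum>r<k. if u < v * ?f r then v * (1 - ?f r) else 0)"
    using \<open>m \<le> k\<close> v discount_le_1[of \<delta> k] \<delta> by (intro sum_mono2) auto
  finally show ?thesis by (simp add: sum.distrib)
qed

text \<open>A single \<open>k\<close> serves all \<open>\<delta>\<close>: it only has to bring
  \<open>(1 + 1 / k) ^ k\<close> close to \<open>exp 1\<close>, since the cross term of the product
  is nonnegative.\<close>

lemma guarantee_ge:
  fixes \<epsilon> :: real
  assumes "\<epsilon> > 0"
  obtains k where "k > 0" "\<And>\<delta>. 0 \<le> \<delta> \<Longrightarrow> \<delta> \<le> 1 \<Longrightarrow> 1 - 1 / exp 1 - \<epsilon> - \<delta> \<le> guarantee \<delta> k"
proof -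
  have "(\<lambda>k. 1 / (1 + 1 / real k) ^ k) \<longlonglongrightarrow> 1 / exp 1"
    by (intro tendsto_intros tendsto_exp_limit_sequentially) auto
  moreover have "1 / exp 1 < 1 / exp 1 + \<epsilon>" using assms by simp
  ultimately have "\<forall>\<^sub>F k in sequentially. 1 / (1 + 1 / real k) ^ k < 1 / exp 1 + \<epsilon>"
    by (rule order_tendstoD)
  then have "\<forall>\<^sub>F k in sequentially. k > 0 \<and> 1 / (1 + 1 / real k) ^ k < 1 / exp 1 + \<epsilon>"
    using eventually_gt_at_top[of 0] by eventually_elim simp
  then obtain k where k: "k > 0" "1 / (1 + 1 / real k) ^ k < 1 / exp 1 + \<epsilon>"
    using eventually_happens'[OF sequentially_bot] by blast
  have "1 - 1 / exp 1 - \<epsilon> - \<delta> \<le> guarantee \<delta> k" if "0 \<le> \<delta>" "\<delta> \<le> 1" for \<delta>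
  proof -
    let ?b = "1 / (1 + 1 / real k) ^ k"
    have "0 \<le> \<delta> * ?b" using that by simp
    moreover have "(1 - \<delta>) * (1 - b) = 1 - \<delta> - b + \<delta> * b" for b :: real
      by (simp add: algebra_simps)
    then have "guarantee \<delta> k = 1 - \<delta> - ?b + \<delta> * ?b"
      by (simp only: guarantee_def)
    ultimately show ?thesis using k(2) by linarith
  qed
  then show ?thesis using that k(1) by blast
qed

section \<open>Expected weight and bounded differences of ranking\<close>

locale ranking =
  fixes S :: "'s set" and w :: "'s \<Rightarrow> real" and Ns :: "'s set list"
    and e :: "'s \<Rightarrow> nat" and \<delta> :: real and k :: nat
  assumes finite_S: "finite S" and inj_e: "inj_on e S"
    and w_nonneg: "\<And>j. j \<in> S \<Longrightarrow> 0 \<le> w j"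
    and Ns_sub: "\<And>N. N \<in> set Ns \<Longrightarrow> N \<subseteq> S"
    and \<delta>: "0 < \<delta>" "\<delta> \<le> 1" and k: "0 < k"
begin

definition unmatched :: "('s \<Rightarrow> nat) \<Rightarrow> 's set" where
  "unmatched \<sigma> = remaining (score \<delta> k w \<sigma>) e S Ns"

definition gain :: "('s \<Rightarrow> nat) \<Rightarrow> real" where
  "gain \<sigma> = (\<Sum>j\<in>S - unmatched \<sigma>. w j)"

text \<open>\<open>utility\<close> and \<open>revenue\<close> are the dual variables of the
  primal-dual argument, for online and offline vertices respectively.\<close>

definition utility :: "('s \<Rightarrow> nat) \<Rightarrow> nat \<Rightarrow> real" where
  "utility \<sigma> i = top_score (score \<delta> k w \<sigma>) (remaining (score \<delta> k w \<sigma>) e S (take i Ns) \<inter> Ns ! i)"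

definition revenue :: "('s \<Rightarrow> nat) \<Rightarrow> 's \<Rightarrow> real" where
  "revenue \<sigma> j = (if j \<in> unmatched \<sigma> then 0 else w j * (1 - discount \<delta> k (\<sigma> j)))"

text \<open>Finitely many ranks make every real function integrable; the default 0 keeps ranks below
  \<open>k\<close> outside \<open>S\<close> too.\<close>

definition ranks :: "('s \<Rightarrow> nat) pmf" where
  "ranks = Pi_pmf S 0 (\<lambda>_. pmf_of_set {..<k})"

lemma set_ranks: "\<sigma> \<in> set_pmf ranks \<Longrightarrow> \<sigma> j < k"
  using k by (cases "j \<in> S") (auto simp: ranks_def set_Pi_pmf[OF finite_S] PiE_dflt_def
      set_pmf_of_set lessThan_empty_iff)

lemma finite_set_ranks: "finite (set_pmf ranks)"
  unfolding ranks_def using k finite_S by (intro finite_set_Pi_pmf) (auto simp: lessThan_empty_iff)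

lemma integrable_ranks: "integrable (measure_pmf ranks) (f :: _ \<Rightarrow> real)"
  by (rule integrable_measure_pmf_finite[OF finite_set_ranks])

lemma score_nonneg:
  assumes "j \<in> S" "\<sigma> j \<le> k"
  shows "0 \<le> score \<delta> k w \<sigma> j"
  using w_nonneg[OF assms(1)] discount_ge[OF \<delta>(2) assms(2)] \<delta>(1) by (simp add: score_def)

lemma unmatched_subset: "unmatched \<sigma> \<subseteq> S"
  unfolding unmatched_def by (rule remaining_subset)

lemma gain_nonneg: "0 \<le> gain \<sigma>"
  unfolding gain_def using w_nonneg by (intro sum_nonneg) auto

lemma utility_nonneg:
  assumes "\<And>j. j \<in> S \<Longrightarrow> \<sigma> j \<le> k"
  shows "0 \<le> utility \<sigma> i"
  unfolding utility_def
proof (rule top_score_nonneg)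
  let ?sc = "score \<delta> k w \<sigma>"
  show "finite (remaining ?sc e S (take i Ns) \<inter> Ns ! i)"
    using finite_subset[OF remaining_subset finite_S] by blast
  show "0 \<le> ?sc j" if "j \<in> remaining ?sc e S (take i Ns) \<inter> Ns ! i" for j
    using that remaining_subset[of ?sc e S "take i Ns"] assms by (intro score_nonneg) auto
qed

lemma revenue_nonneg: "j \<in> S \<Longrightarrow> 0 \<le> revenue \<sigma> j"
  using w_nonneg discount_le_1[OF \<delta>(2)] by (simp add: revenue_def)

text \<open>Each matched \<open>w j\<close> splits into its score, counted by the utilities through
  \<open>sum_top_score\<close>, and the rest, counted as revenue.\<close>

lemma gain_eq: "gain \<sigma> = (\<Sum>i<length Ns. utility \<sigma> i) + (\<Sum>j\<in>S. revenue \<sigma> j)"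
proof -
  have "(\<Sum>j\<in>S. revenue \<sigma> j) = (\<Sum>j\<in>S - unmatched \<sigma>. w j * (1 - discount \<delta> k (\<sigma> j)))"
    using finite_S by (intro sum.mono_neutral_cong_right) (auto simp: revenue_def)
  moreover have "(\<Sum>i<length Ns. utility \<sigma> i) = (\<Sum>j\<in>S - unmatched \<sigma>. score \<delta> k w \<sigma> j)"
    unfolding utility_def unmatched_def by (rule sum_top_score[OF finite_S inj_e])
  ultimately show ?thesis
    by (simp add: gain_def score_def algebra_simps flip: sum.distrib)
qed

text \<open>Weak duality: a matching uses every vertex at most once, and the terms it omits are
  nonnegative.\<close>

lemma gain_ge_matching:
  assumes M: "is_matching Ns M" and \<sigma>: "\<And>j. j \<in> S \<Longrightarrow> \<sigma> j \<le> k"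
  shows "(\<Sum>(i, j)\<in>M. utility \<sigma> i + revenue \<sigma> j) \<le> gain \<sigma>"
proof -
  have inj: "inj_on fst M" "inj_on snd M"
    using M unfolding is_matching_def inj_on_def by force+
  have sub: "fst ` M \<subseteq> {..<length Ns}" "snd ` M \<subseteq> S"
    using M Ns_sub nth_mem unfolding is_matching_def by fastforce+
  have "(\<Sum>(i, j)\<in>M. utility \<sigma> i + revenue \<sigma> j) =
      (\<Sum>i\<in>fst ` M. utility \<sigma> i) + (\<Sum>j\<in>snd ` M. revenue \<sigma> j)"
    by (simp add: sum.reindex inj split_def sum.distrib)
  also have "\<dots> \<le> (\<Sum>i<length Ns. utility \<sigma> i) + (\<Sum>j\<in>S. revenue \<sigma> j)"
    using sub finite_S utility_nonneg[OF \<sigma>] revenue_nonneg by (intro add_mono sum_mono2) auto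
  finally show ?thesis by (simp add: gain_eq)
qed

lemma remaining_upd:
  "remaining (score \<delta> k w (\<sigma>(j := r))) e (S - {j}) Ms = remaining (score \<delta> k w \<sigma>) e (S - {j}) Ms"
  by (rule remaining_cong) (simp add: score_def)

text \<open>Here \<open>u\<close> is the utility of the online vertex when \<open>j\<close> is deleted from the instance; it does
  not depend on the rank of \<open>j\<close>.\<close>
lemma edge_share_ge:
  assumes i: "i < length Ns" "j \<in> Ns ! i" and \<sigma>: "\<And>j. j \<in> S \<Longrightarrow> \<sigma> j \<le> k"
  defines "u \<equiv> top_score (score \<delta> k w \<sigma>) (remaining (score \<delta> k w \<sigma>) e (S - {j}) (take i Ns) \<inter> Ns ! i)"
  shows "u + (if u < w j * discount \<delta> k (\<sigma> j) then w j * (1 - discount \<delta> k (\<sigma> j)) else 0) \<le>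
    utility \<sigma> i + revenue \<sigma> j"
proof -
  let ?sc = "score \<delta> k w \<sigma>"
  have "j \<in> S" using i Ns_sub nth_mem by blast
  then have S: "insert j (S - {j}) = S" by auto
  have fin: "finite (S - {j})" using finite_S by simp
  have sup: "remaining ?sc e (S - {j}) (take i Ns) \<subseteq> remaining ?sc e S (take i Ns)"
    using remaining_insert_supset[OF fin, of e j ?sc "take i Ns", unfolded S, OF inj_e] by simp
  \<comment> \<open>Adding \<open>j\<close> only enlarges the set of free neighbours.\<close>
  have "u \<le> utility \<sigma> i"
    unfolding u_def utility_def
  proof (rule top_score_mono)
    show "finite (remaining ?sc e S (take i Ns) \<inter> Ns ! i)"
      using finite_subset[OF remaining_subset finite_S] by blast
    show "0 \<le> ?sc j" if "j \<in> remaining ?sc e S (take i Ns) \<inter> Ns ! i" for j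
      using that remaining_subset[of ?sc e S "take i Ns"] \<sigma> by (intro score_nonneg) auto
  qed (use sup in auto)
  \<comment> \<open>If \<open>j\<close> is left free, its score does not exceed \<open>u\<close>, so
    the conditional term vanishes.\<close>
  moreover have "?sc j \<le> u" if "j \<in> unmatched \<sigma>"
    using score_le_if_remaining[OF fin, of e j ?sc Ns i, unfolded S, OF inj_e] that i
    by (simp add: u_def unmatched_def)
  moreover have "0 \<le> revenue \<sigma> j" using revenue_nonneg \<open>j \<in> S\<close> by blast
  ultimately show ?thesis by (fastforce simp: revenue_def score_def)
qed

text \<open>With all other ranks fixed, \<open>u\<close> is constant while the rank of
  \<open>j\<close> varies, so \<open>sum_threshold_ge\<close> bounds the average over that rank;
  Fubini then restores the full expectation.\<close>

lemma expectation_edge_share_ge: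
  assumes i: "i < length Ns" "j \<in> Ns ! i"
  shows "guarantee \<delta> k * w j \<le> measure_pmf.expectation ranks (\<lambda>\<sigma>. utility \<sigma> i + revenue \<sigma> j)"
proof -
  let ?share = "\<lambda>\<sigma>. utility \<sigma> i + revenue \<sigma> j"
  have "j \<in> S" using i Ns_sub nth_mem by blast
  then have S: "insert j (S - {j}) = S" by auto
  let ?Q = "Pi_pmf (S - {j}) 0 (\<lambda>_. pmf_of_set {..<k})"
  have k0: "{..<k} \<noteq> {}" using k by auto
  have Q: "\<sigma> x < k" if "\<sigma> \<in> set_pmf ?Q" for \<sigma> x
    using that k k0 finite_S by (cases "x \<in> S - {j}") (auto simp: set_Pi_pmf PiE_dflt_def)
  have int: "integrable (measure_pmf ?Q) f" for f :: "_ \<Rightarrow> real"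
    using finite_S k0 by (intro integrable_measure_pmf_finite finite_set_Pi_pmf) auto
  have *: "guarantee \<delta> k * w j \<le> measure_pmf.expectation (pmf_of_set {..<k}) (\<lambda>r. ?share (\<sigma>(j := r)))"
    if \<sigma>: "\<sigma> \<in> set_pmf ?Q" for \<sigma>
  proof -
    let ?f = "discount \<delta> k"
    define u where "u = top_score (score \<delta> k w \<sigma>) (remaining (score \<delta> k w \<sigma>) e (S - {j}) (take i Ns) \<inter> Ns ! i)"
    have u_upd: "top_score (score \<delta> k w (\<sigma>(j := r)))
        (remaining (score \<delta> k w (\<sigma>(j := r))) e (S - {j}) (take i Ns) \<inter> Ns ! i) = u" for r
    proof -
      have "score \<delta> k w (\<sigma>(j := r)) ` (remaining (score \<delta> k w \<sigma>) e (S - {j}) (take i Ns) \<inter> Ns ! i) =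
          score \<delta> k w \<sigma> ` (remaining (score \<delta> k w \<sigma>) e (S - {j}) (take i Ns) \<inter> Ns ! i)"
        using remaining_subset[of "score \<delta> k w \<sigma>" e "S - {j}" "take i Ns"]
        by (intro image_cong) (auto simp: score_def)
      then show ?thesis by (simp add: u_def top_score_def remaining_upd)
    qed
    have "0 \<le> u"
      unfolding u_def
      using finite_S finite_subset[OF remaining_subset, of "S - {j}"] Q[OF \<sigma>]
        remaining_subset[of "score \<delta> k w \<sigma>" e "S - {j}" "take i Ns"]
      by (intro top_score_nonneg score_nonneg) (auto simp: less_imp_le)
    then have "real k * (guarantee \<delta> k * w j) \<le>
        (\<Sum>r<k. u + (if u < w j * ?f r then w j * (1 - ?f r) else 0))"
      using k \<delta> w_nonneg[OF \<open>j \<in> S\<close>] by (intro sum_threshold_ge) auto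
    also have "\<dots> \<le> (\<Sum>r<k. ?share (\<sigma>(j := r)))"
    proof (rule sum_mono)
      fix r assume "r \<in> {..<k}"
      then have "(\<sigma>(j := r)) x \<le> k" for x using Q[OF \<sigma>, of x] by auto
      then have "x \<in> S \<Longrightarrow> (\<sigma>(j := r)) x \<le> k" for x by blast
      from edge_share_ge[where \<sigma> = "\<sigma>(j := r)", OF i this]
      show "u + (if u < w j * ?f r then w j * (1 - ?f r) else 0) \<le> ?share (\<sigma>(j := r))"
        unfolding u_upd fun_upd_same .
    qed
    finally show ?thesis
      using k by (simp add: integral_pmf_of_set[OF k0] field_simps)
  qed
  have "guarantee \<delta> k * w j = measure_pmf.expectation ?Q (\<lambda>_. guarantee \<delta> k * w j)" by simp
  also have "\<dots> \<le> measure_pmf.expectation ?Q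
      (\<lambda>\<sigma>. measure_pmf.expectation (pmf_of_set {..<k}) (\<lambda>r. ?share (\<sigma>(j := r))))"
    using * by (intro integral_mono_AE int) (auto simp: AE_measure_pmf_iff)
  also have "\<dots> = measure_pmf.expectation ranks ?share"
    using expectation_Pi_pmf_insert[of "S - {j}" j "\<lambda>_. pmf_of_set {..<k}" 0 ?share, unfolded S]
      finite_S k0
    by (simp add: ranks_def)
  finally show ?thesis .
qed

lemma expectation_gain_ge:
  assumes M: "is_matching Ns M"
  shows "guarantee \<delta> k * matching_weight w M \<le> measure_pmf.expectation ranks gain"
proof -
  have "guarantee \<delta> k * matching_weight w M = (\<Sum>(i, j)\<in>M. guarantee \<delta> k * w j)"
    by (simp add: matching_weight_def sum_distrib_left split_def)
  also have "\<dots> \<le> (\<Sum>(i, j)\<in>M. measure_pmf.expectation ranks (\<lambda>\<sigma>. utility \<sigma> i + revenue \<sigma> j))"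
    using M unfolding is_matching_def by (intro sum_mono) (auto intro!: expectation_edge_share_ge)
  also have "\<dots> = measure_pmf.expectation ranks (\<lambda>\<sigma>. \<Sum>(i, j)\<in>M. utility \<sigma> i + revenue \<sigma> j)"
    by (simp add: split_def Bochner_Integration.integral_sum integrable_ranks del: Bochner_Integration.integral_add)
  also have "\<dots> \<le> measure_pmf.expectation ranks gain"
    using gain_ge_matching[OF M] set_ranks
    by (intro integral_mono_AE integrable_ranks) (auto simp: AE_measure_pmf_iff less_imp_le)
  finally show ?thesis .
qed

text \<open>\<open>b\<close> is \<open>w j\<close> plus the weight matched in the run without
  \<open>j\<close>, hence free of the rank of \<open>j\<close>. A surplus vertex \<open>y\<close>
  satisfies \<open>w y * \<delta> \<le> w j\<close>, as its discount is at least
  \<open>\<delta>\<close> and its score at most that of \<open>j\<close>.\<close>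

lemma gain_bounds:
  assumes "j \<in> S" and \<sigma>: "\<And>j. j \<in> S \<Longrightarrow> \<sigma> j \<le> k"
  defines "b \<equiv> sum w S - sum w (remaining (score \<delta> k w \<sigma>) e (S - {j}) Ns)"
  shows "b - w j / \<delta> \<le> gain \<sigma>" "gain \<sigma> \<le> b"
proof -
  let ?R = "remaining (score \<delta> k w \<sigma>) e (S - {j}) Ns"
  have S: "insert j (S - {j}) = S" using assms(1) by auto
  have wj: "0 \<le> w j / \<delta>" using w_nonneg assms(1) \<delta> by simp
  have finR: "finite ?R" using finite_S finite_subset[OF remaining_subset, of "S - {j}"] by simp
  have g: "gain \<sigma> = sum w S - sum w (unmatched \<sigma>)"
    unfolding gain_def by (rule sum_diff[OF finite_S unmatched_subset])
  have "unmatched \<sigma> = ?R \<or> (\<exists>y. y \<in> S \<and> y \<notin> ?R \<and> score \<delta> k w \<sigma> y \<le> score \<delta> k w \<sigma> j \<and>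
       unmatched \<sigma> = insert y ?R)"
    using remaining_insert[of "S - {j}" e j "score \<delta> k w \<sigma>" Ns] finite_S inj_e
    unfolding S unmatched_def by simp
  then have "0 \<le> sum w (unmatched \<sigma>) - sum w ?R \<and> sum w (unmatched \<sigma>) - sum w ?R \<le> w j / \<delta>"
  proof (elim disjE exE conjE)
    fix y assume y: "y \<in> S" "y \<notin> ?R" "score \<delta> k w \<sigma> y \<le> score \<delta> k w \<sigma> j" "unmatched \<sigma> = insert y ?R"
    have "w y * \<delta> \<le> w y * discount \<delta> k (\<sigma> y)"
      using y(1) w_nonneg \<sigma> \<delta> by (intro mult_left_mono discount_ge) auto
    also have "\<dots> \<le> w j * discount \<delta> k (\<sigma> j)" using y(3) by (simp add: score_def)
    also have "\<dots> \<le> w j * 1"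
      using w_nonneg assms(1) \<delta> by (intro mult_left_mono discount_le_1) auto
    finally show ?thesis using \<delta> y finR w_nonneg by (simp add: pos_le_divide_eq)
  qed (use wj in simp)
  then show "b - w j / \<delta> \<le> gain \<sigma>" "gain \<sigma> \<le> b" unfolding g b_def by linarith+
qed

text \<open>Both gains lie in one interval of length \<open>w j / \<delta>\<close>, whose ends do
  not change with the rank of \<open>j\<close>.\<close>

lemma gain_bounded_differences:
  assumes "j \<in> S" "\<sigma> \<in> set_pmf ranks" "r < k"
  shows "\<bar>gain (\<sigma>(j := r)) - gain \<sigma>\<bar> \<le> w j / \<delta>"
proof -
  have "\<sigma> x \<le> k" "(\<sigma>(j := r)) x \<le> k" for x
    using set_ranks[OF assms(2), of x] assms(3) by auto
  with gain_bounds[OF assms(1), of \<sigma>] gain_bounds[OF assms(1), of "\<sigma>(j := r)"]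
  show ?thesis unfolding remaining_upd by (simp del: fun_upd_apply)
qed

lemma prob_gain_lower_tail:
  assumes "(\<Sum>j\<in>S. (w j)\<^sup>2) > 0" "t > 0" and a: "a + t \<le> measure_pmf.expectation ranks gain"
  shows "measure_pmf.prob ranks {\<sigma>. gain \<sigma> < a} \<le> exp (- 2 * t\<^sup>2 * \<delta>\<^sup>2 / (\<Sum>j\<in>S. (w j)\<^sup>2))"
proof -
  have k0: "{..<k} \<noteq> {}" using k by auto
  have C: "(\<Sum>j\<in>S. (w j / \<delta>)\<^sup>2) = (\<Sum>j\<in>S. (w j)\<^sup>2) / \<delta>\<^sup>2"
    by (simp add: power_divide sum_divide_distrib)
  have "measure_pmf.prob ranks {\<sigma>. gain \<sigma> < a} \<le>
      measure_pmf.prob ranks {\<sigma>. gain \<sigma> \<le> measure_pmf.expectation ranks gain - t}"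
    using a by (intro measure_pmf.finite_measure_mono) auto
  also have "\<dots> \<le> exp (- 2 * t\<^sup>2 / (\<Sum>j\<in>S. (w j / \<delta>)\<^sup>2))"
    unfolding ranks_def
  proof (rule McDiarmid_lower_tail)
    fix j \<sigma> r assume "j \<in> S" "\<sigma> \<in> set_pmf (Pi_pmf S 0 (\<lambda>_. pmf_of_set {..<k}))"
      "r \<in> set_pmf (pmf_of_set {..<k})"
    then show "\<bar>gain (\<sigma>(j := r)) - gain \<sigma>\<bar> \<le> w j / \<delta>"
      using gain_bounded_differences k0 by (simp add: ranks_def)
  qed (use assms finite_S k0 \<delta> C in auto)
  finally show ?thesis by (simp add: C)
qed

definition strategy :: "('s \<Rightarrow> nat) \<Rightarrow> 's history \<Rightarrow> 's set \<Rightarrow> 's option" where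
  "strategy \<sigma> h N = top_choice (score \<delta> k w \<sigma>) e ((S - matched_in h) \<inter> N)"

end

section \<open>From deterministic strategies to the randomized algorithm\<close>

lemma matched_in_snoc: "matched_in (h @ [(N, c)]) = matched_in h \<union> set_option c"
  by (auto simp: matched_in_def)

lemma hist_weight_snoc:
  "hist_weight w (h @ [(N, c)]) = hist_weight w h + (\<Sum>j\<in>set_option c. w j)"
  by (cases c) (auto simp: hist_weight_def)

text \<open>The top choice is always legal, so the play records it unchanged and follows
  \<open>remaining\<close> step by step.\<close>

lemma hist_weight_play:
  assumes "finite S" "inj_on e S"
    and D: "\<And>h N. D h N = top_choice sc e ((S - matched_in h) \<inter> N)"
  shows "hist_weight w (play D h Ns) =
    hist_weight w h + (\<Sum>j\<in>(S - matched_in h) - remaining sc e (S - matched_in h) Ns. w j)"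
proof (induction Ns arbitrary: h)
  case (Cons N Ns)
  let ?X = "S - matched_in h"
  let ?c = "top_choice sc e (?X \<inter> N)"
  have c: "set_option ?c \<subseteq> ?X \<inter> N"
    using top_choice_mem[of "?X \<inter> N" e sc] assms(1) inj_on_subset[OF assms(2), of "?X \<inter> N"]
    by (auto simp: subset_iff)
  then have legal: "legal_choice h N ?c = ?c"
    by (cases ?c) (auto simp: legal_choice_def)
  have X: "S - (matched_in h \<union> set_option ?c) = ?X - set_option ?c" by auto
  let ?R = "remaining sc e (?X - set_option ?c) Ns"
  have "?R \<subseteq> ?X - set_option ?c" by (rule remaining_subset)
  then have "?X - ?R = set_option ?c \<union> (?X - set_option ?c - ?R)"
    using c by auto
  then have "sum w (?X - ?R) = sum w (set_option ?c) + sum w (?X - set_option ?c - ?R)"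
    using assms(1) by (subst sum.union_disjoint[symmetric]) auto
  then show ?case
    using Cons.IH[of "h @ [(N, ?c)]"] by (simp add: D legal matched_in_snoc hist_weight_snoc X)
qed simp

text \<open>Lottery and strategies are built from \<open>S\<close>, \<open>w\<close>,
  \<open>\<delta>\<close> and \<open>k\<close> alone, without the arrivals; \<open>SOME\<close>
  fixes one numbering for breaking ties.\<close>

definition ranking_alg :: "real \<Rightarrow> nat \<Rightarrow> 's online_alg" where
  "ranking_alg \<delta> k S w = behaviour (ranking.ranks S k)
     (ranking.strategy S w (SOME e. inj_on e S) \<delta> k)"

theorem theorem3:
  fixes \<alpha> :: real
  assumes "\<alpha> > 0"
  shows "\<exists>A :: 's online_alg.
    \<forall>(S :: 's set) (w :: 's \<Rightarrow> real) (Ns :: 's set list) (Mstar :: (nat \<times> 's) set).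
      finite S \<longrightarrow> (\<forall>j\<in>S. w j \<ge> 0) \<longrightarrow> (\<forall>N\<in>set Ns. N \<subseteq> S) \<longrightarrow>
      is_matching Ns Mstar \<longrightarrow>
      measure_pmf.prob (run_alg A S w Ns)
        {h. hist_weight w h < (1 - 1 / exp 1 - \<alpha>) * matching_weight w Mstar}
      < exp (- (1/50) * \<alpha> ^ 4 * (matching_weight w Mstar ^ 2 / (\<Sum>j\<in>S. (w j)\<^sup>2)))"
proof -
  \<comment> \<open>The cap at 1 keeps \<open>\<delta>\<close> admissible for large
    \<open>\<alpha>\<close>; in the main case it is \<open>\<alpha> / 2\<close>.\<close>
  define \<delta> where "\<delta> = min 1 (\<alpha> / 2)"
  have \<delta>: "0 < \<delta>" "\<delta> \<le> 1" using assms by (auto simp: \<delta>_def)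
  \<comment> \<open>Of the loss \<open>\<alpha>\<close>, a half goes to the truncation, a quarter to
    the discretisation, and a quarter is left for the deviation.\<close>
  obtain k where k: "k > 0"
    and G: "\<And>\<delta>. 0 \<le> \<delta> \<Longrightarrow> \<delta> \<le> 1 \<Longrightarrow> 1 - 1 / exp 1 - \<alpha> / 4 - \<delta> \<le> guarantee \<delta> k"
    using guarantee_ge[of "\<alpha> / 4"] assms by auto
  show ?thesis
  proof (intro exI[of _ "ranking_alg \<delta> k"] allI impI)
    fix S :: "'s set" and w :: "'s \<Rightarrow> real" and Ns Mstar
    assume S: "finite S" and w: "\<forall>j\<in>S. w j \<ge> 0" and Ns: "\<forall>N\<in>set Ns. N \<subseteq> S"
      and M: "is_matching Ns Mstar"
    define e :: "'s \<Rightarrow> nat" where "e = (SOME e. inj_on e S)"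
    have "\<exists>e :: 's \<Rightarrow> nat. inj_on e S"
      using finite_imp_inj_to_nat_seg[OF S] by blast
    then have "inj_on e S" unfolding e_def by (rule someI_ex)
    then interpret ranking S w Ns e \<delta> k
      using S w Ns \<delta> k by unfold_locales auto
    let ?W = "matching_weight w Mstar" and ?V = "\<Sum>j\<in>S. (w j)\<^sup>2"
    let ?a = "(1 - 1 / exp 1 - \<alpha>) * ?W"
    have "run_alg (ranking_alg \<delta> k) S w Ns = map_pmf (\<lambda>\<sigma>. play (strategy \<sigma>) [] Ns) ranks"
      by (rule run_alg_behaviour) (simp add: ranking_alg_def e_def)
    moreover have "hist_weight w (play (strategy \<sigma>) [] Ns) = gain \<sigma>" for \<sigma>
      using hist_weight_play[OF finite_S inj_e strategy_def, of w \<sigma> "[]" Ns]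
      by (simp add: gain_def unmatched_def matched_in_def hist_weight_def)
    ultimately have P: "measure_pmf.prob (run_alg (ranking_alg \<delta> k) S w Ns) {h. hist_weight w h < ?a} =
        measure_pmf.prob ranks {\<sigma>. gain \<sigma> < ?a}"
      by (simp add: vimage_def)
    have mem: "j \<in> S" if "(i, j) \<in> Mstar" for i j
      using that M Ns nth_mem unfolding is_matching_def by fastforce
    have W_nonneg: "?W \<ge> 0"
      unfolding matching_weight_def using w mem by (intro sum_nonneg) auto
    show "measure_pmf.prob (run_alg (ranking_alg \<delta> k) S w Ns) {h. hist_weight w h < ?a}
      < exp (- (1/50) * \<alpha> ^ 4 * (?W ^ 2 / ?V))"
    proof (cases "?W > 0 \<and> \<alpha> \<le> 1")
      \<comment> \<open>The target is not positive, whereas the gain is nonnegative, so the event is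
        empty. This also covers vanishing weights, where the quotient in the exponent is a division
        by zero.\<close>
      case False
      have "?a \<le> 0"
      proof (cases "?W > 0")
        case True
        have "(0::real) < 1 / exp 1" by simp
        then have "1 - 1 / exp 1 - \<alpha> \<le> 0" using True False by linarith
        then show ?thesis using True by (simp add: mult_nonpos_nonneg)
      qed (use W_nonneg in auto)
      then have "{\<sigma>. gain \<sigma> < ?a} = {}" using gain_nonneg by (fastforce dest: order_less_le_trans)
      then show ?thesis unfolding P by simp
    next
      case True
      then have \<delta>_eq: "\<delta> = \<alpha> / 2" by (simp add: \<delta>_def)
      \<comment> \<open>A matching of positive weight forces \<open>?V\<close> to be positive, as
        McDiarmid's inequality requires.\<close>
      have "\<exists>j\<in>S. w j \<noteq> 0"
      proof (rule ccontr)
        assume "\<not> (\<exists>j\<in>S. w j \<noteq> 0)"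
        then have "?W = 0" unfolding matching_weight_def using mem by (intro sum.neutral) auto
        then show False using True by simp
      qed
      then have V: "?V > 0" using S by (meson sum_pos2 zero_le_power2 zero_less_power2)
      have "?a + \<alpha> / 4 * ?W \<le> guarantee \<delta> k * ?W"
        using mult_right_mono[OF G[of \<delta>] W_nonneg] \<delta> by (simp add: \<delta>_eq algebra_simps)
      also have "\<dots> \<le> measure_pmf.expectation ranks gain" by (rule expectation_gain_ge[OF M])
      finally have "measure_pmf.prob ranks {\<sigma>. gain \<sigma> < ?a} \<le>
          exp (- 2 * (\<alpha> / 4 * ?W)\<^sup>2 * \<delta>\<^sup>2 / ?V)"
        using V True assms by (intro prob_gain_lower_tail) auto
      \<comment> \<open>The constant is \<open>2 * (1 / 16) * (1 / 4) = 1 / 32\<close>; its margin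
        over \<open>1 / 50\<close> makes the final inequality strict.\<close>
      also have "- 2 * (\<alpha> / 4 * ?W)\<^sup>2 * \<delta>\<^sup>2 / ?V = - (1/32) * (\<alpha> ^ 4 * (?W ^ 2 / ?V))"
        by (simp add: \<delta>_eq power2_eq_square power4_eq_xxxx)
      also have "exp \<dots> < exp (- (1/50) * (\<alpha> ^ 4 * (?W ^ 2 / ?V)))"
      proof -
        have "0 < \<alpha> ^ 4 * (?W ^ 2 / ?V)" using V True assms by simp
        then show ?thesis by simp
      qed
      finally show ?thesis unfolding P by (simp add: mult.assoc)
    qed
  qed
qed

end
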